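(* As $x\to\infty$, $$\sum_{i,j\le x}(i,j)^{\ast\ast}=F\,x^2\log x+O(x^2),$$ where $$F:=\zeta(2)\prod_{q}\left(1-\frac{4}{q^2}+\frac{4}{q^3}-\frac1{q^4}\right),$$ the product being over all primes $q$.
   Context: A positive divisor $d$ of a positive integer $n$ is a unitary divisor of $n$, written $d\parallel n$, if $\gcd(d,n/d)=1$. For positive integers $i,j$, $(i,j)^{\ast\ast}$ is the greatest common unitary divisor of $i$ and $j$ (the largest $d$ with $d\parallel i$ and $d\parallel j$). The sum is over all ordered pairs of positive integers $i,j\le x$, and $\zeta$ is the Riemann zeta function. *)

theory Defs
  imports
    "HOL-Analysis.Analysis"
    "HOL-Computational_Algebra.Primes"
    "HOL-Library.Landau_Symbols"
begin

definition unitary_dvd :: "nat \<Rightarrow> nat \<Rightarrow> bool"  (infix "\<parallel>\<^sub>u" 50)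
  where "d \<parallel>\<^sub>u n \<longleftrightarrow> n > 0 \<and> d dvd n \<and> coprime d (n div d)"

text \<open>Meaningful for positive arguments only; the set then contains 1 and is finite.\<close>

definition gcud :: "nat \<Rightarrow> nat \<Rightarrow> nat"
  where "gcud i j = Max {d. d \<parallel>\<^sub>u i \<and> d \<parallel>\<^sub>u j}"

text \<open>The Dirichlet series of the Riemann zeta function, which represents it for real
  arguments \<open>s > 1\<close> only. The summation index is shifted by one.\<close>

definition zeta_real :: "real \<Rightarrow> real"
  where "zeta_real s = (\<Sum>n. 1 / real (Suc n) powr s)"

text \<open>The product over the primes is an infinite product over all natural numbers
  in increasing order, with factor 1 at the non-primes.\<close>

definition gcud_const :: real
  where "gcud_const = zeta_real 2 *
    (\<Prod>q. if prime q then 1 - 4 / real q ^ 2 + 4 / real q ^ 3 - 1 / real q ^ 4 else 1)"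

end

theory Submission
  imports Defs
begin

text \<open>
  Write \<open>\<phi>\<^sup>*\<close> for the unitary totient, the multiplicative function with
  \<open>\<phi>\<^sup>*(p\<^sup>k) = p\<^sup>k - 1\<close>. Its sum over the unitary divisors of an integer is that integer, and
  the common unitary divisors of \<open>i\<close> and \<open>j\<close> are the unitary divisors of \<open>gcud i j\<close>. Hence
  \<open>gcud i j\<close> is the sum of \<open>\<phi>\<^sup>*(d)\<close> over all common unitary divisors \<open>d\<close>
  (\<open>gcud_eq_sum_unitary_totient\<close>). The multiples of \<open>d\<close> up to \<open>x\<close> that have \<open>d\<close> as a unitary
  divisor are the \<open>d m\<close> with \<open>m \<le> x / d\<close> coprime to \<open>d\<close>, so the sum in question equals
  \<open>\<Sum>d\<le>x. \<phi>\<^sup>*(d) c(d)\<^sup>2\<close>, where \<open>c(d)\<close> counts these \<open>m\<close> (\<open>gcud_sum\<close>).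

  Sieving by the primes that divide \<open>d\<close> gives \<open>c(d) = \<rho>(d) x / d\<close> with
  \<open>\<rho>(d) = (\<Prod>p | d. 1 - 1/p)\<close> up to an error. The classical error bound, 2 to the number of
  prime factors of \<open>d\<close>, is too weak: summed over \<open>d\<close> it costs a logarithm. The error is
  therefore measured differently: the floor of \<open>t\<close> differs from \<open>t\<close> by at most \<open>min 1 t \<le> sqrt t\<close>,
  which leads to the bound \<open>sqrt y (\<Prod>p | d. 1 + 1/sqrt p)\<close> with \<open>y = x / d\<close> (\<open>sieve_bound\<close>).
  The product is bounded on average over \<open>d\<close>, and the total error is then \<open>O(x\<^sup>2)\<close>
  (\<open>gcud_sum_approximation\<close>).

  It remains to show \<open>\<Sum>d\<le>x. \<phi>\<^sup>*(d) \<rho>(d)\<^sup>2 / d\<^sup>2 = F ln x + O(1)\<close> (\<open>density_log_sum\<close>). The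
  multiplicative summand is the Dirichlet convolution of \<open>1/n\<close>, \<open>1/n\<^sup>2\<close> and a function \<open>k\<close> that
  is supported on cube-free integers (\<open>density_factorization\<close>). Starting from the
  harmonic sum, a convolution with a function \<open>g\<close> for which \<open>\<Sum>|g m| sqrt m\<close> converges
  multiplies the coefficient of \<open>ln x\<close> by \<open>\<Sum>g\<close> and keeps the error bounded
  (\<open>log_sum_dconv\<close>). The factor \<open>1/n\<^sup>2\<close> contributes \<open>\<zeta>(2)\<close>, and \<open>k\<close> contributes \<open>\<Sum>k\<close>, which is the
  product over the primes in \<open>F\<close> by an Euler product (\<open>euler_product_bounded_exponent\<close>).
\<close>

section \<open>Multiplicative functions and Dirichlet convolution\<close>

definition multiplicative :: "(nat \<Rightarrow> real) \<Rightarrow> bool"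
  where "multiplicative f \<longleftrightarrow>
    f 1 = 1 \<and> (\<forall>a b. a > 0 \<longrightarrow> b > 0 \<longrightarrow> coprime a b \<longrightarrow> f (a * b) = f a * f b)"

definition dconv :: "(nat \<Rightarrow> real) \<Rightarrow> (nat \<Rightarrow> real) \<Rightarrow> nat \<Rightarrow> real"
  where "dconv f g n = (\<Sum>d | d dvd n. f d * g (n div d))"

text \<open>
  The multiplicative function with prescribed values \<open>F p k\<close> at the prime powers \<open>p\<^sup>k\<close>,
  \<open>k \<ge> 1\<close>. Its value at 0 is set to 0, so that sums over all natural numbers are sums over
  the positive ones.
\<close>

definition from_prime_powers :: "(nat \<Rightarrow> nat \<Rightarrow> real) \<Rightarrow> nat \<Rightarrow> real"
  where "from_prime_powers F n =
    (if n = 0 then 0 else \<Prod>p\<in>prime_factors n. F p (multiplicity p n))"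

lemma multiplicative_1: "multiplicative f \<Longrightarrow> f 1 = 1"
  by (simp add: multiplicative_def)

lemma multiplicative_mult:
  "multiplicative f \<Longrightarrow> a > 0 \<Longrightarrow> b > 0 \<Longrightarrow> coprime a b \<Longrightarrow> f (a * b) = f a * f b"
  by (simp add: multiplicative_def)

lemma multiplicative_times:
  "multiplicative f \<Longrightarrow> multiplicative g \<Longrightarrow> multiplicative (\<lambda>n. f n * g n)"
  by (simp add: multiplicative_def)

lemma multiplicative_inverse_power: "multiplicative (\<lambda>n. 1 / real n ^ k)"
  by (simp add: multiplicative_def power_mult_distrib)

lemma multiplicity_coprime_times:
  fixes a b p :: nat
  assumes "prime p" "p dvd a" "coprime a b" "a > 0" "b > 0"
  shows "multiplicity p (a * b) = multiplicity p a"
proof -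
  have "\<not> p dvd b"
    using assms by (metis coprime_common_divisor not_prime_unit)
  then have "multiplicity p b = 0"
    by (simp add: not_dvd_imp_multiplicity_0)
  then show ?thesis
    using assms by (simp add: prime_elem_multiplicity_mult_distrib)
qed

lemma multiplicative_from_prime_powers: "multiplicative (from_prime_powers F)"
  unfolding multiplicative_def
proof (intro conjI allI impI)
  show "from_prime_powers F 1 = 1" by (simp add: from_prime_powers_def)
next
  fix a b :: nat
  assume ab: "a > 0" "b > 0" "coprime a b"
  have disj: "prime_factors a \<inter> prime_factors b = {}"
    using ab(3) by (meson disjoint_iff coprime_common_divisor in_prime_factors_imp_dvd
        in_prime_factors_imp_prime not_prime_unit)
  have "from_prime_powers F (a * b) =
      (\<Prod>p\<in>prime_factors a \<union> prime_factors b. F p (multiplicity p (a * b)))"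
    using ab by (simp add: from_prime_powers_def prime_factors_product)
  also have "\<dots> = (\<Prod>p\<in>prime_factors a. F p (multiplicity p (a * b))) *
      (\<Prod>p\<in>prime_factors b. F p (multiplicity p (a * b)))"
    using disj by (intro prod.union_disjoint) auto
  also have "(\<Prod>p\<in>prime_factors a. F p (multiplicity p (a * b))) =
      (\<Prod>p\<in>prime_factors a. F p (multiplicity p a))"
    using ab by (intro prod.cong refl)
      (simp add: multiplicity_coprime_times in_prime_factors_iff)
  also have "(\<Prod>p\<in>prime_factors b. F p (multiplicity p (a * b))) =
      (\<Prod>p\<in>prime_factors b. F p (multiplicity p b))"
    using ab by (intro prod.cong refl)
      (subst mult.commute, simp add: multiplicity_coprime_times in_prime_factors_iff coprime_commute)
  finally show "from_prime_powers F (a * b) = from_prime_powers F a * from_prime_powers F b"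
    using ab by (simp add: from_prime_powers_def)
qed

lemma from_prime_powers_prime_power:
  assumes "prime p" "k > 0"
  shows "from_prime_powers F (p ^ k) = F p k"
proof -
  have "prime_factors (p ^ k) = {p}"
    using assms by (simp add: prime_factorization_prime_power)
  then show ?thesis
    using assms by (auto simp: from_prime_powers_def)
qed

text \<open>
  Splitting off the full power of one prime leaves a smaller coprime cofactor, so induction
  reduces an identity of multiplicative functions to the prime powers.
\<close>

lemma multiplicative_eqI:
  assumes f: "multiplicative f" and g: "multiplicative g"
    and eq: "\<And>p k. prime p \<Longrightarrow> k > 0 \<Longrightarrow> f (p ^ k) = g (p ^ k)"
    and "n > 0"
  shows "f n = g n"
  using \<open>n > 0\<close>
proof (induction n rule: less_induct)
  case (less n)
  show ?case
  proof (cases "n = 1")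
    case True
    then show ?thesis using multiplicative_1[OF f] multiplicative_1[OF g] by simp
  next
    case False
    then obtain p where p: "prime p" "p dvd n"
      using prime_factor_nat by blast
    obtain m where m: "n = p ^ multiplicity p n * m" "\<not> p dvd m"
      using multiplicity_decompose'[of n p] less.prems p by (metis not_prime_unit gr_implies_not0)
    have k: "multiplicity p n > 0"
      using p less.prems by (simp add: prime_multiplicity_gt_zero_iff)
    have "m > 0" using m less.prems by (cases m) auto
    have "p ^ multiplicity p n > 1"
      using k prime_gt_1_nat[OF p(1)] by (rule one_less_power[rotated])
    then have "m < n" using m(1) \<open>m > 0\<close>
      by (metis mult.commute mult.right_neutral nat_mult_less_cancel1)
    have cop: "coprime (p ^ multiplicity p n) m"
      using m(2) p(1) by (simp add: prime_imp_coprime coprime_power_left_iff)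
    have pos: "p ^ multiplicity p n > 0" using p(1) by (simp add: prime_gt_0_nat)
    have "f n = f (p ^ multiplicity p n) * f m"
      by (subst m(1)) (rule multiplicative_mult[OF f pos \<open>m > 0\<close> cop])
    also have "\<dots> = g (p ^ multiplicity p n) * g m"
      using eq[OF p(1) k] less.IH[OF \<open>m < n\<close> \<open>m > 0\<close>] by simp
    also have "\<dots> = g n"
      by (subst (2) m(1)) (rule multiplicative_mult[OF g pos \<open>m > 0\<close> cop, symmetric])
    finally show ?thesis .
  qed
qed

text \<open>
  For coprime \<open>a\<close> and \<open>b\<close> every divisor of \<open>a b\<close> is a product of a divisor of \<open>a\<close> and a
  divisor of \<open>b\<close> in exactly one way, which splits the convolution sum into a product.
\<close>

lemma multiplicative_dconv:
  assumes f: "multiplicative f" and g: "multiplicative g"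
  shows "multiplicative (dconv f g)"
  unfolding multiplicative_def
proof (intro conjI allI impI)
  show "dconv f g 1 = 1"
    using multiplicative_1[OF f] multiplicative_1[OF g] by (simp add: dconv_def)
next
  fix a b :: nat
  assume ab: "a > 0" "b > 0" "coprime a b"
  have inj: "inj_on (\<lambda>(c, d). c * d) ({c. c dvd a} \<times> {d. d dvd b})"
  proof (rule inj_onI, clarify)
    fix c d c' d' :: nat
    assume *: "c dvd a" "d dvd b" "c' dvd a" "d' dvd b" "c * d = c' * d'"
    have "coprime c d'" "coprime c' d"
      using * ab(3) by (meson coprime_divisors)+
    moreover have "c dvd c' * d'" "c' dvd c * d"
      using *(5) by (metis dvd_triv_left)+
    ultimately have "c dvd c'" "c' dvd c"
      by (simp_all add: coprime_dvd_mult_left_iff)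
    then have "c = c'" by (simp add: dvd_antisym)
    moreover have "c > 0" using * ab by (simp add: dvd_pos_nat)
    ultimately show "c = c' \<and> d = d'" using *(5) by simp
  qed
  have im: "(\<lambda>(c, d). c * d) ` ({c. c dvd a} \<times> {d. d dvd b}) = {e. e dvd a * b}"
  proof (intro equalityI subsetI)
    fix e assume "e \<in> {e. e dvd a * b}"
    then obtain c d where "e = c * d" "c dvd a" "d dvd b"
      by (auto elim: division_decomp)
        (metis (no_types, lifting) division_decomp)
    then show "e \<in> (\<lambda>(c, d). c * d) ` ({c. c dvd a} \<times> {d. d dvd b})" by auto
  qed (auto intro: mult_dvd_mono)
  have "dconv f g (a * b) =
      (\<Sum>e\<in>(\<lambda>(c, d). c * d) ` ({c. c dvd a} \<times> {d. d dvd b}). f e * g (a * b div e))"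
    by (simp only: dconv_def im)
  also have "\<dots> = (\<Sum>(c, d)\<in>{c. c dvd a} \<times> {d. d dvd b}. f (c * d) * g (a * b div (c * d)))"
    using inj by (simp add: sum.reindex case_prod_unfold)
  also have "\<dots> = (\<Sum>(c, d)\<in>{c. c dvd a} \<times> {d. d dvd b}.
      (f c * g (a div c)) * (f d * g (b div d)))"
  proof (intro sum.cong refl, clarify)
    fix c d assume cd: "c dvd a" "d dvd b"
    then obtain c' d' where cd': "a = c * c'" "b = d * d'" by (meson dvdE)
    have pos: "c > 0" "d > 0" "c' > 0" "d' > 0" using ab cd' by (auto intro: gr0I)
    have "coprime c d" "coprime c' d'"
      using ab(3) unfolding cd' by simp_all
    then have "f (c * d) = f c * f d" "g (c' * d') = g c' * g d'"
      using pos by (simp_all add: multiplicative_mult[OF f] multiplicative_mult[OF g])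
    moreover have "a * b div (c * d) = c' * d'"
    proof -
      have "a * b = c' * d' * (c * d)" by (simp add: cd' mult_ac)
      then show ?thesis using pos by simp
    qed
    moreover have "a div c = c'" "b div d = d'" using pos by (simp_all add: cd')
    ultimately show "f (c * d) * g (a * b div (c * d)) =
        (f c * g (a div c)) * (f d * g (b div d))"
      by simp
  qed
  also have "\<dots> = dconv f g a * dconv f g b"
    by (simp add: dconv_def sum_product sum.cartesian_product)
  finally show "dconv f g (a * b) = dconv f g a * dconv f g b" .
qed

lemma dconv_prime_power:
  assumes "prime p"
  shows "dconv f g (p ^ k) = (\<Sum>i\<le>k. f (p ^ i) * g (p ^ (k - i)))"
proof -
  have "{d. d dvd p ^ k} = (\<lambda>i. p ^ i) ` {..k}"
    using assms by (auto simp: divides_primepow_nat)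
  moreover have "inj_on (\<lambda>i. p ^ i) {..k}"
    using prime_gt_1_nat[OF assms] by (auto intro!: inj_onI dest: power_inject_exp[THEN iffD1, rotated])
  ultimately have "dconv f g (p ^ k) = (\<Sum>i\<le>k. f (p ^ i) * g (p ^ k div p ^ i))"
    by (simp add: dconv_def sum.reindex)
  also have "\<dots> = (\<Sum>i\<le>k. f (p ^ i) * g (p ^ (k - i)))"
    using prime_gt_0_nat[OF assms] by (intro sum.cong refl) (simp add: power_diff)
  finally show ?thesis .
qed

section \<open>Logarithmic sums under convolution\<close>

text \<open>
  Both sides run over the pairs \<open>(m, l)\<close> with \<open>m l \<le> N\<close>: the left one groups them by
  \<open>n = m l\<close>, the right one by \<open>m\<close>.
\<close>

lemma sum_dconv:
  "(\<Sum>n = 1..N. dconv f g n) = (\<Sum>m = 1..N. f m * (\<Sum>l = 1..N div m. g l))"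
proof -
  have "(\<Sum>n = 1..N. dconv f g n) =
      (\<Sum>(n, d)\<in>(SIGMA n:{1..N}. {d. d dvd n}). f d * g (n div d))"
    unfolding dconv_def by (rule sum.Sigma) auto
  also have "\<dots> = (\<Sum>(m, l)\<in>(SIGMA m:{1..N}. {1..N div m}). f m * g l)"
  proof (rule sum.reindex_bij_witness[where i = "\<lambda>(m, l). (m * l, m)"
        and j = "\<lambda>(n, d). (d, n div d)"], goal_cases)
    case (2 x)
    then obtain n d where x: "x = (n, d)" "n \<ge> 1" "n \<le> N" "d dvd n" by auto
    then have "d \<ge> 1" "d \<le> n" by (auto simp: dvd_imp_le Suc_le_eq intro: dvd_pos_nat)
    moreover have "n div d \<ge> 1" using \<open>d \<le> n\<close> \<open>d \<ge> 1\<close> x(2)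
      by (metis Suc_le_eq div_greater_zero_iff One_nat_def)
    ultimately show ?case using x by (auto intro: div_le_mono)
  next
    case (4 x)
    then show ?case by (auto simp: less_eq_div_iff_mult_less_eq mult.commute)
  qed (auto simp: dvd_def)
  also have "\<dots> = (\<Sum>m = 1..N. f m * (\<Sum>l = 1..N div m. g l))"
    by (simp add: sum.Sigma sum_distrib_left)
  finally show ?thesis .
qed

lemma nat_floor_divide: "x \<ge> 0 \<Longrightarrow> nat \<lfloor>x / real m\<rfloor> = nat \<lfloor>x\<rfloor> div m"
  using floor_divide_real_eq_div[of "int m" x] by (simp add: nat_div_distrib)

lemma one_plus_ln_le: "m \<ge> 1 \<Longrightarrow> 1 + ln (real m) \<le> 2 * sqrt (real m)"
proof -
  assume "m \<ge> 1"
  then have "ln (real m) = 2 * ln (sqrt (real m))" by (simp add: ln_sqrt)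
  also have "ln (sqrt (real m)) \<le> sqrt (real m) - 1"
    using \<open>m \<ge> 1\<close> by (intro ln_le_minus_one) auto
  finally show ?thesis by simp
qed

lemma summable_abs_if_summable_sqrt:
  fixes g :: "nat \<Rightarrow> real"
  assumes "summable (\<lambda>m. \<bar>g m\<bar> * sqrt (real m))"
  shows "summable (\<lambda>m. \<bar>g m\<bar>)"
proof (rule summable_comparison_test'[OF assms, of 1])
  fix m :: nat assume "m \<ge> 1"
  then show "norm \<bar>g m\<bar> \<le> \<bar>g m\<bar> * sqrt (real m)"
    by (simp add: mult_left_le_one_le mult_le_cancel_left1)
qed

text \<open>
  Write \<open>s x\<close> for the sum of \<open>a\<close> up to \<open>x\<close>. The sum of the convolution is \<open>\<Sum>m. g m * s (x/m)\<close>,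
  where all \<open>m > x\<close> contribute 0. Compared with \<open>\<Sum>m. g m * \<alpha> ln x\<close>, each term is off by at most
  \<open>|g m| (C + |\<alpha>| ln m)\<close>: for \<open>m \<le> x\<close> because \<open>ln (x/m) = ln x - ln m\<close>, and for \<open>m > x\<close> because
  \<open>ln x < ln m\<close>. As \<open>1 + ln m \<le> 2 sqrt m\<close>, these errors are summable, and the bound does not depend on \<open>x\<close>.
\<close>

lemma log_sum_dconv:
  fixes a g :: "nat \<Rightarrow> real"
  assumes A: "\<And>x. x \<ge> 1 \<Longrightarrow> \<bar>(\<Sum>n = 1..nat \<lfloor>x\<rfloor>. a n) - \<alpha> * ln x\<bar> \<le> C"
    and g0: "g 0 = 0"
    and g: "summable (\<lambda>m. \<bar>g m\<bar> * sqrt (real m))"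
  shows "\<exists>C'. \<forall>x\<ge>1. \<bar>(\<Sum>n = 1..nat \<lfloor>x\<rfloor>. dconv g a n) - \<alpha> * suminf g * ln x\<bar> \<le> C'"
proof -
  define s where "s = (\<lambda>x::real. \<Sum>n = 1..nat \<lfloor>x\<rfloor>. a n)"
  define K where "K = 2 * (C + \<bar>\<alpha>\<bar>)"
  have C: "C \<ge> 0" using A[of 1] by linarith
  have sg: "summable g"
    using summable_abs_if_summable_sqrt[OF g] by (rule summable_rabs_cancel)
  have "\<bar>(\<Sum>n = 1..nat \<lfloor>x\<rfloor>. dconv g a n) - \<alpha> * suminf g * ln x\<bar> \<le>
      (\<Sum>m. K * (\<bar>g m\<bar> * sqrt (real m)))" if x: "x \<ge> 1" for x :: real
  proof -
    define t where "t = (\<lambda>m. s (x / real m) - \<alpha> * ln x)"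
    have bound: "\<bar>g m * t m\<bar> \<le> K * (\<bar>g m\<bar> * sqrt (real m))" for m
    proof (cases "m = 0")
      case False
      then have m: "m \<ge> 1" by simp
      have "\<bar>t m\<bar> \<le> C + \<bar>\<alpha>\<bar> * ln (real m)"
      proof (cases "real m \<le> x")
        case True
        then have "x / real m \<ge> 1" using m by simp
        then have "\<bar>s (x / real m) - \<alpha> * ln (x / real m)\<bar> \<le> C"
          unfolding s_def by (rule A)
        moreover have "t m = (s (x / real m) - \<alpha> * ln (x / real m)) - \<alpha> * ln (real m)"
          using m x by (simp add: t_def ln_div algebra_simps)
        moreover have "\<bar>\<alpha> * ln (real m)\<bar> = \<bar>\<alpha>\<bar> * ln (real m)"
          using m by (simp add: abs_mult)
        ultimately show ?thesis by linarith
      next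
        case False
        then have "\<lfloor>x / real m\<rfloor> = 0"
          using x m by (simp add: floor_eq_iff)
        then have "t m = - (\<alpha> * ln x)" by (simp add: t_def s_def)
        moreover have "\<bar>\<alpha> * ln x\<bar> \<le> \<bar>\<alpha>\<bar> * ln (real m)"
          using False x by (simp add: abs_mult mult_left_mono)
        ultimately show ?thesis using C by simp
      qed
      also have "\<dots> \<le> (C + \<bar>\<alpha>\<bar>) * (1 + ln (real m))"
        using C m by (simp add: algebra_simps)
      also have "\<dots> \<le> (C + \<bar>\<alpha>\<bar>) * (2 * sqrt (real m))"
        using C one_plus_ln_le[OF m] by (intro mult_left_mono) auto
      finally have "\<bar>g m\<bar> * \<bar>t m\<bar> \<le> \<bar>g m\<bar> * ((C + \<bar>\<alpha>\<bar>) * (2 * sqrt (real m)))"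
        by (intro mult_left_mono) auto
      then show ?thesis by (simp add: abs_mult K_def mult_ac)
    qed (simp add: g0)
    have sK: "summable (\<lambda>m. K * (\<bar>g m\<bar> * sqrt (real m)))"
      by (rule summable_mult[OF g])
    have st: "summable (\<lambda>m. \<bar>g m * t m\<bar>)"
      by (rule summable_comparison_test'[OF sK]) (use bound in auto)
    have "(\<lambda>m. g m * s (x / real m)) sums (\<Sum>m = 1..nat \<lfloor>x\<rfloor>. g m * s (x / real m))"
    proof (rule sums_finite)
      fix m assume m: "m \<notin> {1..nat \<lfloor>x\<rfloor>}"
      show "g m * s (x / real m) = 0"
      proof (cases "m = 0")
        case False
        then have "x < real m" using m x by (simp add: not_le) linarith
        then have "\<lfloor>x / real m\<rfloor> = 0" using x False by (simp add: floor_eq_iff)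
        then show ?thesis by (simp add: s_def)
      qed (simp add: g0)
    qed simp
    moreover have "(\<Sum>m = 1..nat \<lfloor>x\<rfloor>. g m * s (x / real m)) =
        (\<Sum>n = 1..nat \<lfloor>x\<rfloor>. dconv g a n)"
      using x unfolding sum_dconv s_def by (simp add: nat_floor_divide)
    ultimately have "(\<lambda>m. g m * s (x / real m) - g m * (\<alpha> * ln x)) sums
        ((\<Sum>n = 1..nat \<lfloor>x\<rfloor>. dconv g a n) - suminf g * (\<alpha> * ln x))"
      by (intro sums_diff sums_mult2 summable_sums sg) simp
    then have "(\<Sum>m. g m * t m) =
        (\<Sum>n = 1..nat \<lfloor>x\<rfloor>. dconv g a n) - \<alpha> * suminf g * ln x"
      by (simp add: t_def right_diff_distrib sums_iff mult_ac)
    moreover have "\<bar>\<Sum>m. g m * t m\<bar> \<le> (\<Sum>m. \<bar>g m * t m\<bar>)"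
      by (rule summable_rabs[OF st])
    moreover have "\<dots> \<le> (\<Sum>m. K * (\<bar>g m\<bar> * sqrt (real m)))"
      by (rule suminf_le[OF bound st sK])
    ultimately show ?thesis by simp
  qed
  then show ?thesis by blast
qed

text \<open>
  The factor 1 gives the statement the form of the hypothesis of \<open>log_sum_dconv\<close> with \<open>\<alpha> = 1\<close>.
\<close>

lemma harmonic_sum_bound:
  assumes "x \<ge> 1"
  shows "\<bar>(\<Sum>n = 1..nat \<lfloor>x\<rfloor>. 1 / real n) - 1 * ln x\<bar> \<le> 1"
proof -
  define N where "N = nat \<lfloor>x\<rfloor>"
  have N: "N \<ge> 1" "real N \<le> x" "x < real N + 1"
    using assms by (simp_all add: N_def le_nat_floor)
  have "(\<Sum>n = 1..N. 1 / real n) = harm N"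
    by (simp add: harm_def inverse_eq_divide)
  moreover have "ln x \<le> harm N"
    using harm_ge_ln[of N] N assms by (smt (verit) ln_mono)
  moreover have "harm N - ln (real N) \<le> (1::real)"
    using euler_mascheroni_sequence_decreasing[of 1 N] N by (simp add: harm_def)
  moreover have "ln (real N) \<le> ln x" using N by simp
  ultimately show ?thesis by (simp add: N_def)
qed

section \<open>Euler products with bounded exponents\<close>

definition bounded_exponent_numbers :: "nat set \<Rightarrow> nat \<Rightarrow> nat set"
  where "bounded_exponent_numbers S r =
    {n. n > 0 \<and> prime_factors n \<subseteq> S \<and> (\<forall>p\<in>S. multiplicity p n \<le> r)}"

text \<open>
  By unique factorization the exponent of a new prime can be chosen independently of the rest.
  This is the induction step for finite Euler products.
\<close>

lemma bounded_exponent_numbers_insert: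
  assumes p: "prime p" "p \<notin> S" and S: "\<And>q. q \<in> S \<Longrightarrow> prime q"
  shows "bij_betw (\<lambda>(i, m). p ^ i * m) ({..r} \<times> bounded_exponent_numbers S r) (bounded_exponent_numbers (insert p S) r)"
proof -
  have ndvd: "\<not> p dvd m" if "m \<in> bounded_exponent_numbers S r" for m
    using that p by (auto simp: bounded_exponent_numbers_def prime_factors_dvd)
  have mult: "multiplicity p (p ^ i * m) = i" if "m \<in> bounded_exponent_numbers S r" for i m
    using ndvd[OF that] p(1) by (intro multiplicity_eqI) (auto simp: mult.commute[of "p ^ i"])
  have mult': "multiplicity q (p ^ i * m) = multiplicity q m"
    if "q \<in> S" "m \<in> bounded_exponent_numbers S r" for q i m
  proof -
    have "q \<noteq> p" "m \<noteq> 0" using that p(2) by (auto simp: bounded_exponent_numbers_def)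
    then show ?thesis
      using p(1) S[OF that(1)]
      by (simp add: prime_elem_multiplicity_mult_distrib multiplicity_distinct_prime_power)
  qed
  show ?thesis
  proof (rule bij_betw_imageI)
    show "inj_on (\<lambda>(i, m). p ^ i * m) ({..r} \<times> bounded_exponent_numbers S r)"
    proof (rule inj_onI, clarify)
      fix i j m m'
      assume *: "m \<in> bounded_exponent_numbers S r" "m' \<in> bounded_exponent_numbers S r" "p ^ i * m = p ^ j * m'"
      then have "i = j" using mult by metis
      then show "i = j \<and> m = m'" using * prime_gt_0_nat[OF p(1)] by simp
    qed
  next
    show "(\<lambda>(i, m). p ^ i * m) ` ({..r} \<times> bounded_exponent_numbers S r) = bounded_exponent_numbers (insert p S) r"
    proof (intro equalityI subsetI)
      fix n assume "n \<in> (\<lambda>(i, m). p ^ i * m) ` ({..r} \<times> bounded_exponent_numbers S r)"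
      then obtain i m where im: "n = p ^ i * m" "i \<le> r" "m \<in> bounded_exponent_numbers S r" by auto
      have "prime_factors n \<subseteq> insert p S"
      proof
        fix q assume "q \<in> prime_factors n"
        then have q: "prime q" "q dvd p ^ i \<or> q dvd m"
          using im(1) by (metis in_prime_factors_iff prime_dvd_mult_iff)+
        from q(2) show "q \<in> insert p S"
        proof
          assume "q dvd p ^ i"
          then show ?thesis using q(1) p(1) by (metis insertI1 prime_dvd_power primes_dvd_imp_eq)
        next
          assume "q dvd m"
          then show ?thesis using q(1) im(3) by (auto simp: bounded_exponent_numbers_def prime_factors_dvd)
        qed
      qed
      then show "n \<in> bounded_exponent_numbers (insert p S) r"
        using im mult[OF im(3)] mult'[OF _ im(3)] prime_gt_0_nat[OF p(1)]
        by (auto simp: bounded_exponent_numbers_def)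
    next
      fix n assume n: "n \<in> bounded_exponent_numbers (insert p S) r"
      then have "n \<noteq> 0" by (simp add: bounded_exponent_numbers_def)
      then obtain m where m: "n = p ^ multiplicity p n * m" "\<not> p dvd m"
        using multiplicity_decompose'[of n p] p(1) by (metis not_prime_unit)
      have "m > 0" using m(1) \<open>n \<noteq> 0\<close> by (cases m) auto
      have le: "multiplicity p n \<le> r" using n by (simp add: bounded_exponent_numbers_def)
      have "prime_factors m \<subseteq> S"
      proof
        fix q assume "q \<in> prime_factors m"
        then have q: "prime q" "q dvd m" by (auto simp: prime_factors_dvd)
        then have "q dvd n" using m(1) by (metis dvd_mult)
        then have "q \<in> insert p S"
          using n q(1) \<open>n \<noteq> 0\<close> by (auto simp: bounded_exponent_numbers_def prime_factors_dvd)
        then show "q \<in> S" using q(2) m(2) by auto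
      qed
      moreover have "multiplicity q m \<le> r" if "q \<in> S" for q
      proof -
        have "multiplicity q m \<le> multiplicity q n"
          using m(1) \<open>n \<noteq> 0\<close> by (intro dvd_imp_multiplicity_le) (metis dvd_triv_right)
        then show ?thesis using n that by (force simp: bounded_exponent_numbers_def)
      qed
      ultimately have "m \<in> bounded_exponent_numbers S r"
        using \<open>m > 0\<close> by (simp add: bounded_exponent_numbers_def)
      then show "n \<in> (\<lambda>(i, m). p ^ i * m) ` ({..r} \<times> bounded_exponent_numbers S r)"
        using m(1) le by (intro image_eqI[of _ _ "(multiplicity p n, m)"]) auto
    qed
  qed
qed

lemma bounded_exponent_sum:
  assumes f: "multiplicative f" and "finite S" and "\<And>p. p \<in> S \<Longrightarrow> prime p"
  shows "finite (bounded_exponent_numbers S r) \<and>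
    (\<Sum>n\<in>bounded_exponent_numbers S r. f n) = (\<Prod>p\<in>S. \<Sum>i\<le>r. f (p ^ i))"
  using assms(2,3)
proof (induction S rule: finite_induct)
  case empty
  have "bounded_exponent_numbers {} r = {1}"
    by (auto simp: bounded_exponent_numbers_def prime_factorization_empty_iff)
  then show ?case using multiplicative_1[OF f] by simp
next
  case (insert p S)
  have p: "prime p" using insert.prems by simp
  have S: "prime q" if "q \<in> S" for q using that insert.prems by simp
  note bij = bounded_exponent_numbers_insert[OF p insert.hyps(2) S, of r]
  have IH: "finite (bounded_exponent_numbers S r)"
    "(\<Sum>n\<in>bounded_exponent_numbers S r. f n) = (\<Prod>p\<in>S. \<Sum>i\<le>r. f (p ^ i))"
    using insert.IH S by auto
  have "(\<Sum>n\<in>bounded_exponent_numbers (insert p S) r. f n) =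
      (\<Sum>(i, m)\<in>{..r} \<times> bounded_exponent_numbers S r. f (p ^ i * m))"
    using sum.reindex_bij_betw[OF bij, of f] by (simp add: case_prod_unfold)
  also have "\<dots> = (\<Sum>(i, m)\<in>{..r} \<times> bounded_exponent_numbers S r. f (p ^ i) * f m)"
  proof (intro sum.cong refl, clarify)
    fix i m assume m: "m \<in> bounded_exponent_numbers S r"
    then have "\<not> p dvd m"
      using p insert.hyps(2) by (auto simp: bounded_exponent_numbers_def prime_factors_dvd)
    then have "coprime (p ^ i) m"
      using p by (simp add: prime_imp_coprime coprime_power_left_iff)
    then show "f (p ^ i * m) = f (p ^ i) * f m"
      using m prime_gt_0_nat[OF p]
      by (intro multiplicative_mult[OF f]) (auto simp: bounded_exponent_numbers_def)
  qed
  also have "\<dots> = (\<Sum>i\<le>r. f (p ^ i)) * (\<Sum>m\<in>bounded_exponent_numbers S r. f m)"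
    by (simp add: sum_product sum.cartesian_product)
  finally show ?case
    using IH bij_betw_finite[OF bij] insert.hyps by simp
qed

text \<open>
  Let \<open>A N\<close> be the set of integers with prime factors up to \<open>N\<close> and exponents at most \<open>r\<close>. The
  finite Euler product over the primes up to \<open>N\<close> is the sum of \<open>f\<close> over \<open>A N\<close>. As \<open>f\<close> vanishes at
  every \<open>n \<le> N\<close> outside \<open>A N\<close>, these sums exhaust the whole series. Applied to \<open>|f|\<close>, the same
  identity bounds the partial sums by \<open>\<Prod>(1 + b p) \<le> exp (\<Sum>b)\<close>, which yields absolute
  convergence.
\<close>

theorem euler_product_bounded_exponent:
  fixes f :: "nat \<Rightarrow> real"
  assumes f: "multiplicative f" and f0: "f 0 = 0"
    and vanish: "\<And>p i. prime p \<Longrightarrow> i > r \<Longrightarrow> f (p ^ i) = 0"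
    and b: "summable b" "\<And>p. prime p \<Longrightarrow> (\<Sum>i = 1..r. \<bar>f (p ^ i)\<bar>) \<le> b p" "\<And>n. b n \<ge> 0"
  shows "summable (\<lambda>n. \<bar>f n\<bar>)"
    and "(\<lambda>N. \<Prod>q\<le>N. if prime q then \<Sum>i\<le>r. f (q ^ i) else 1) \<longlonglongrightarrow> suminf f"
proof -
  define A where "A = (\<lambda>N. bounded_exponent_numbers {p. prime p \<and> p \<le> N} r)"
  have zero: "f n = 0" if n: "n \<le> N" "n \<notin> A N" for n N
  proof (cases "n = 0")
    case False
    have "prime_factors n \<subseteq> {p. prime p \<and> p \<le> N}"
      using n(1) False by (auto simp: prime_factors_dvd dest: dvd_imp_le)
    then obtain p where p: "prime p" "multiplicity p n > r"
      using n(2) False by (auto simp: A_def bounded_exponent_numbers_def not_le)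
    obtain m where m: "n = p ^ multiplicity p n * m" "\<not> p dvd m"
      using multiplicity_decompose'[of n p] p(1) False by (metis not_prime_unit)
    have "m > 0" using m(1) False by (cases m) auto
    moreover have "coprime (p ^ multiplicity p n) m"
      using m(2) p(1) by (simp add: prime_imp_coprime coprime_power_left_iff)
    ultimately have "f (p ^ multiplicity p n * m) = f (p ^ multiplicity p n) * f m"
      using prime_gt_0_nat[OF p(1)] by (intro multiplicative_mult[OF f]) auto
    then show ?thesis using m(1) vanish[OF p] by simp
  qed (simp add: f0)
  have A: "finite (A N)"
    "(\<Sum>n\<in>A N. g n) = (\<Prod>p | prime p \<and> p \<le> N. \<Sum>i\<le>r. g (p ^ i))"
    if "multiplicative g" for g N
  proof -
    have "finite {p. prime p \<and> p \<le> N}" by simp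
    from bounded_exponent_sum[OF that this, of r]
    show "finite (A N)"
      "(\<Sum>n\<in>A N. g n) = (\<Prod>p | prime p \<and> p \<le> N. \<Sum>i\<le>r. g (p ^ i))"
      unfolding A_def by blast+
  qed
  have absf: "multiplicative (\<lambda>n. \<bar>f n\<bar>)"
    using f by (simp add: multiplicative_def abs_mult)
  show sum: "summable (\<lambda>n. \<bar>f n\<bar>)"
  proof (rule bounded_imp_summable)
    fix N
    have "(\<Sum>n\<le>N. \<bar>f n\<bar>) \<le> (\<Sum>n\<in>A N \<union> {..N}. \<bar>f n\<bar>)"
      using A(1)[OF f] by (intro sum_mono2) auto
    also have "\<dots> = (\<Sum>n\<in>A N. \<bar>f n\<bar>)"
      using A(1)[OF f] zero by (intro sum.mono_neutral_right) auto
    also have "\<dots> = (\<Prod>p | prime p \<and> p \<le> N. \<Sum>i\<le>r. \<bar>f (p ^ i)\<bar>)"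
      by (rule A(2)[OF absf])
    also have "\<dots> \<le> (\<Prod>p | prime p \<and> p \<le> N. exp (b p))"
    proof (intro prod_mono conjI)
      fix p assume "p \<in> {p. prime p \<and> p \<le> N}"
      then have "(\<Sum>i = 1..r. \<bar>f (p ^ i)\<bar>) \<le> b p" using b(2) by simp
      moreover have "(\<Sum>i\<le>r. \<bar>f (p ^ i)\<bar>) = 1 + (\<Sum>i = 1..r. \<bar>f (p ^ i)\<bar>)"
        using multiplicative_1[OF f]
        by (simp add: atMost_atLeast0 sum.atLeast_Suc_atMost)
      ultimately show "(\<Sum>i\<le>r. \<bar>f (p ^ i)\<bar>) \<le> exp (b p)"
        using exp_ge_add_one_self[of "b p"] by linarith
    qed (simp add: sum_nonneg)
    also have "\<dots> = exp (\<Sum>p | prime p \<and> p \<le> N. b p)"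
      by (simp add: exp_sum)
    also have "\<dots> \<le> exp (suminf b)"
      using sum_le_suminf[OF b(1), of "{p. prime p \<and> p \<le> N}"] b(3) by simp
    finally show "(\<Sum>n\<le>N. \<bar>f n\<bar>) \<le> exp (suminf b)" .
  qed simp
  \<comment> \<open>Adding \<open>{..N}\<close> to \<open>A N\<close> does not change the sum and makes the sets exhaust the natural numbers.\<close>
  have "(f has_sum suminf f) UNIV"
    using sum by (intro norm_summable_imp_has_sum) (auto intro: summable_sums summable_rabs_cancel)
  then have lim: "(sum f \<longlongrightarrow> suminf f) (finite_subsets_at_top UNIV)"
    by (simp add: has_sum_def)
  have "filterlim (\<lambda>N. A N \<union> {..N}) (finite_subsets_at_top UNIV) sequentially"
    unfolding filterlim_finite_subsets_at_top
  proof (intro allI impI)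
    fix X :: "nat set" assume X: "finite X \<and> X \<subseteq> UNIV"
    show "\<forall>\<^sub>F N in sequentially. finite (A N \<union> {..N}) \<and> X \<subseteq> A N \<union> {..N} \<and> A N \<union> {..N} \<subseteq> UNIV"
      using eventually_ge_at_top[of "Max (insert 0 X)"]
    proof eventually_elim
      case (elim N)
      then show ?case using X A(1)[OF f] by auto
    qed
  qed
  from filterlim_compose[OF lim this]
  have "(\<lambda>N. sum f (A N \<union> {..N})) \<longlonglongrightarrow> suminf f" .
  moreover have "sum f (A N \<union> {..N}) = (\<Prod>q\<le>N. if prime q then \<Sum>i\<le>r. f (q ^ i) else 1)" for N
  proof -
    have "sum f (A N \<union> {..N}) = sum f (A N)"
      using A(1)[OF f] zero by (intro sum.mono_neutral_right) auto
    also have "\<dots> = (\<Prod>p | prime p \<and> p \<le> N. \<Sum>i\<le>r. f (p ^ i))"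
      by (rule A(2)[OF f])
    also have "\<dots> = (\<Prod>q\<le>N. if prime q then \<Sum>i\<le>r. f (q ^ i) else 1)"
      by (intro prod.mono_neutral_cong_left) auto
    finally show ?thesis .
  qed
  ultimately show "(\<lambda>N. \<Prod>q\<le>N. if prime q then \<Sum>i\<le>r. f (q ^ i) else 1) \<longlonglongrightarrow> suminf f"
    by simp
qed

section \<open>The logarithmic mean of the local densities\<close>

definition unitary_totient :: "nat \<Rightarrow> real"
  where "unitary_totient = from_prime_powers (\<lambda>p k. real p ^ k - 1)"

text \<open>
  For \<open>n > 0\<close> the natural density of the integers coprime to \<open>n\<close>, in other words \<open>\<phi>(n) / n\<close> for
  Euler's totient \<open>\<phi>\<close>.
\<close>

definition coprime_density :: "nat \<Rightarrow> real"
  where "coprime_density = from_prime_powers (\<lambda>p k. 1 - 1 / real p)"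

text \<open>
  With \<open>u = 1/p\<close> and a formal variable \<open>w\<close> that marks the exponent of \<open>p\<close>, the values
  of \<open>\<phi>\<^sup>*(n) \<rho>(n)\<^sup>2 / n\<^sup>2\<close> at \<open>p\<^sup>k\<close>, which are \<open>(1 - u\<^sup>k) (1 - u)\<^sup>2 u\<^sup>k\<close> for \<open>k \<ge> 1\<close> and 1 for \<open>k = 0\<close>,
  have a generating series with denominator \<open>(1 - u w) (1 - u\<^sup>2 w)\<close>. The two factors of the denominator are those of \<open>1/n\<close> and
  \<open>1/n\<^sup>2\<close>; the numerator is \<open>1 + (- 4 u\<^sup>2 + 3 u\<^sup>3 - u\<^sup>4) w + u\<^sup>3 w\<^sup>2\<close>, whose coefficients are the
  values below.
\<close>

definition cubefree_factor :: "nat \<Rightarrow> real"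
  where "cubefree_factor = from_prime_powers (\<lambda>p k.
    if k = 1 then - 4 / real p ^ 2 + 3 / real p ^ 3 - 1 / real p ^ 4
    else if k = 2 then 1 / real p ^ 3 else 0)"

lemma cubefree_factor_prime:
  assumes "prime p"
  shows "cubefree_factor p = - 4 / real p ^ 2 + 3 / real p ^ 3 - 1 / real p ^ 4"
    and "cubefree_factor (p ^ 2) = 1 / real p ^ 3"
    and "i > 2 \<Longrightarrow> cubefree_factor (p ^ i) = 0"
  using from_prime_powers_prime_power[OF assms, of 1] from_prime_powers_prime_power[OF assms, of 2]
    from_prime_powers_prime_power[OF assms, of i]
  by (simp_all add: cubefree_factor_def)

lemma multiplicative_inverse_nat: "multiplicative (\<lambda>n. 1 / real n)"
  using multiplicative_inverse_power[of 1] by simp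

text \<open>
  The convolution at \<open>p\<^sup>k\<close> is \<open>u\<^sup>k (1 + u + \<dots> + u\<^sup>k)\<close> with \<open>u = 1/p\<close>; multiplying by \<open>1 - u\<close> turns
  the geometric sum into a polynomial.
\<close>

lemma dconv_inverse_squares_prime_power:
  assumes "prime p"
  shows "(1 - 1 / real p) * dconv (\<lambda>n. 1 / real n ^ 2) (\<lambda>n. 1 / real n) (p ^ k) =
    (1 / real p) ^ k * (1 - (1 / real p) ^ Suc k)"
proof -
  define u where "u = 1 / real p"
  have "dconv (\<lambda>n. 1 / real n ^ 2) (\<lambda>n. 1 / real n) (p ^ k) =
      (\<Sum>i\<le>k. 1 / real (p ^ i) ^ 2 * (1 / real (p ^ (k - i))))"
    by (rule dconv_prime_power[OF assms])
  also have "\<dots> = (\<Sum>i\<le>k. u ^ k * u ^ i)"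
  proof (intro sum.cong refl)
    fix i assume "i \<in> {..k}"
    then have "u ^ k * u ^ i = (u ^ i) ^ 2 * u ^ (k - i)"
      by (simp add: power2_eq_square add.commute flip: power_add)
    then show "1 / real (p ^ i) ^ 2 * (1 / real (p ^ (k - i))) = u ^ k * u ^ i"
      by (simp add: u_def power_one_over)
  qed
  also have "\<dots> = u ^ k * (\<Sum>i\<le>k. u ^ i)"
    by (simp add: sum_distrib_left)
  finally have "(1 - u) * dconv (\<lambda>n. 1 / real n ^ 2) (\<lambda>n. 1 / real n) (p ^ k) =
      u ^ k * ((1 - u) * (\<Sum>i\<le>k. u ^ i))"
    by (simp add: mult_ac)
  also have "(1 - u) * (\<Sum>i\<le>k. u ^ i) = 1 - u ^ Suc k"
    by (rule sum_gp_basic)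
  finally show ?thesis by (simp add: u_def)
qed

text \<open>
  Both sides are multiplicative, so prime powers suffice. There only three terms of the
  convolution with the cube-free factor survive, and after multiplication by \<open>1 - 1/p\<close> the
  claim is a polynomial identity.
\<close>

lemma density_factorization:
  assumes "n > 0"
  shows "unitary_totient n * coprime_density n ^ 2 / real n ^ 2 =
    dconv cubefree_factor (dconv (\<lambda>n. 1 / real n ^ 2) (\<lambda>n. 1 / real n)) n"
proof -
  let ?s = "dconv (\<lambda>n. 1 / real n ^ 2) (\<lambda>n. 1 / real n)"
  let ?a = "\<lambda>n. unitary_totient n * (coprime_density n * coprime_density n) * (1 / real n ^ 2)"
  have mk: "multiplicative cubefree_factor"
    unfolding cubefree_factor_def by (rule multiplicative_from_prime_powers)
  have "?a n = dconv cubefree_factor ?s n"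
  proof (rule multiplicative_eqI[OF _ _ _ assms])
    show "multiplicative ?a"
      unfolding unitary_totient_def coprime_density_def
      by (intro multiplicative_times multiplicative_from_prime_powers multiplicative_inverse_power)
    show "multiplicative (dconv cubefree_factor ?s)"
      using multiplicative_inverse_power[of 2] multiplicative_inverse_nat mk
      by (intro multiplicative_dconv)
  next
    fix p k :: nat assume p: "prime p" and k: "k > 0"
    define u where "u = 1 / real p"
    have u: "u \<noteq> 1" using prime_gt_1_nat[OF p] by (simp add: u_def)
    have pu: "real p = 1 / u" by (simp add: u_def)
    have u0: "u \<noteq> 0" using prime_gt_0_nat[OF p] by (simp add: u_def)
    define s where "s = (\<lambda>i. ?s (p ^ i))"
    have s: "(1 - u) * s i = u ^ i * (1 - u ^ Suc i)" for i
      unfolding s_def u_def by (rule dconv_inverse_squares_prime_power[OF p])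
    have c1: "cubefree_factor p = - 4 * u ^ 2 + 3 * u ^ 3 - u ^ 4"
      and c2: "cubefree_factor (p ^ 2) = u ^ 3"
      using cubefree_factor_prime[OF p] by (simp_all add: u_def power_one_over)
    have c0: "cubefree_factor 1 = 1" by (rule multiplicative_1[OF mk])
    have lhs: "?a (p ^ k) = (1 - u ^ k) * (1 - u) ^ 2 * u ^ k"
      using k p prime_gt_0_nat[OF p]
      by (simp add: unitary_totient_def coprime_density_def from_prime_powers_prime_power
          u_def power_one_over power2_eq_square field_simps)
    have conv: "dconv cubefree_factor ?s (p ^ k) = (\<Sum>i\<le>k. cubefree_factor (p ^ i) * s (k - i))"
      unfolding dconv_prime_power[OF p] s_def ..
    have "(1 - u) * dconv cubefree_factor ?s (p ^ k) = (1 - u) ^ 3 * (1 - u ^ k) * u ^ k"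
    proof (cases "k = 1")
      case True
      have "dconv cubefree_factor ?s (p ^ k) = s 1 + cubefree_factor p * s 0"
        using c0 conv True by simp
      then have "(1 - u) * dconv cubefree_factor ?s (p ^ k) =
          (1 - u) * s 1 + cubefree_factor p * ((1 - u) * s 0)"
        by (simp add: algebra_simps)
      also have "\<dots> = (1 - u) ^ 3 * (1 - u ^ k) * u ^ k"
        unfolding s c1 True by (simp add: power2_eq_square power3_eq_cube power4_eq_xxxx algebra_simps)
      finally show ?thesis .
    next
      case False
      then obtain j where j: "k = Suc (Suc j)"
        using k by (metis One_nat_def not0_implies_Suc less_not_refl)
      have "dconv cubefree_factor ?s (p ^ k) =
          (\<Sum>i\<in>{0, 1, 2}. cubefree_factor (p ^ i) * s (k - i))"
        unfolding conv using cubefree_factor_prime(3)[OF p] j by (intro sum.mono_neutral_right) auto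
      also have "\<dots> = s k + cubefree_factor p * s (Suc j) + cubefree_factor (p ^ 2) * s j"
        using c0 j by simp
      finally have "(1 - u) * dconv cubefree_factor ?s (p ^ k) =
          (1 - u) * s k + cubefree_factor p * ((1 - u) * s (Suc j)) +
          cubefree_factor (p ^ 2) * ((1 - u) * s j)"
        by (simp add: algebra_simps)
      also have "\<dots> = (1 - u) ^ 3 * (1 - u ^ k) * u ^ k"
        unfolding s c1 c2 j
        by (simp add: power2_eq_square power3_eq_cube power4_eq_xxxx algebra_simps)
      finally show ?thesis .
    qed
    then have "(1 - u) * dconv cubefree_factor ?s (p ^ k) =
        (1 - u) * ((1 - u ^ k) * (1 - u) ^ 2 * u ^ k)"
      by (simp add: power2_eq_square power3_eq_cube mult_ac)
    then show "?a (p ^ k) = dconv cubefree_factor ?s (p ^ k)"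
      using u lhs by simp
  qed
  then show ?thesis by (simp add: power2_eq_square)
qed

lemma summable_sqrt_over_square: "summable (\<lambda>n. sqrt (real n) / real n ^ 2)"
proof -
  have "summable (\<lambda>n. real n powr (- 3 / 2))"
    by (simp add: summable_real_powr_iff)
  moreover have "real n powr (- 3 / 2) = sqrt (real n) / real n ^ 2" for n
  proof (cases "n = 0")
    case False
    then have "sqrt (real n) / real n ^ 2 = real n powr (1 / 2) / real n powr 2"
      by (simp add: powr_half_sqrt)
    also have "\<dots> = real n powr (1 / 2 - 2)" by (rule powr_diff[symmetric])
    also have "1 / 2 - 2 = (- 3 / 2 :: real)" by simp
    finally show ?thesis by simp
  qed simp
  ultimately show ?thesis by simp
qed

text \<open>
  The values at \<open>p\<close> and \<open>p\<^sup>2\<close> are \<open>O(1/p\<^sup>2)\<close> and \<open>1/p\<^sup>3\<close>, small enough to afford the weight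
  \<open>sqrt n\<close>. The Euler factor \<open>1 + k(p) + k(p\<^sup>2)\<close> is \<open>1 - 4/p\<^sup>2 + 4/p\<^sup>3 - 1/p\<^sup>4\<close>.
\<close>

lemma cubefree_factor_sums:
  shows "summable (\<lambda>n. \<bar>cubefree_factor n\<bar> * sqrt (real n))"
    and "zeta_real 2 * suminf cubefree_factor = gcud_const"
proof -
  let ?k = cubefree_factor
  \<comment> \<open>9 is 8 for the prime, from \<open>4 + 3 + 1\<close>, plus 1 for its square.\<close>
  define b where "b = (\<lambda>n. 9 * (sqrt (real n) / real n ^ 2))"
  have b: "summable b" "\<And>n. b n \<ge> 0"
    using summable_mult[OF summable_sqrt_over_square, of 9] by (simp_all add: b_def)
  have mk: "multiplicative ?k"
    unfolding cubefree_factor_def by (rule multiplicative_from_prime_powers)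
  have mk': "multiplicative (\<lambda>n. \<bar>?k n\<bar> * sqrt (real n))"
    using mk by (simp add: multiplicative_def abs_mult real_sqrt_mult)
  have k0: "?k 0 = 0" by (simp add: cubefree_factor_def from_prime_powers_def)
  have two: "{1..2::nat} = {1, 2}" by auto
  have bound: "\<bar>?k p\<bar> * sqrt (real p) + \<bar>?k (p ^ 2)\<bar> * real p \<le> b p" if p: "prime p" for p
  proof -
    have p1: "real p \<ge> 1" using prime_ge_1_nat[OF p] by simp
    have "\<bar>?k p\<bar> \<le> 8 / real p ^ 2"
    proof -
      have "3 / real p ^ 3 \<le> 3 / real p ^ 2" "1 / real p ^ 4 \<le> 1 / real p ^ 2"
        using p1 by (auto intro!: divide_left_mono power_increasing)
      moreover have "3 / real p ^ 3 \<ge> 0" "1 / real p ^ 4 \<ge> 0" "1 / real p ^ 2 \<ge> 0" by simp_all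
      ultimately show ?thesis unfolding cubefree_factor_prime(1)[OF p] by linarith
    qed
    then have "\<bar>?k p\<bar> * sqrt (real p) \<le> 8 / real p ^ 2 * sqrt (real p)"
      by (intro mult_right_mono) auto
    moreover have "\<bar>?k (p ^ 2)\<bar> * real p = 1 / real p ^ 2"
      using p1 unfolding cubefree_factor_prime(2)[OF p]
      by (simp add: power2_eq_square power3_eq_cube)
    moreover have "1 / real p ^ 2 \<le> sqrt (real p) / real p ^ 2"
      using p1 by (intro divide_right_mono) auto
    ultimately show ?thesis by (simp add: b_def)
  qed
  have "summable (\<lambda>n. \<bar>\<bar>?k n\<bar> * sqrt (real n)\<bar>)"
  proof (rule euler_product_bounded_exponent(1)[OF mk' _ _ b(1) _ b(2), of 2])
    fix p :: nat assume p: "prime p"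
    show "(\<Sum>i = 1..2. \<bar>\<bar>?k (p ^ i)\<bar> * sqrt (real (p ^ i))\<bar>) \<le> b p"
      using bound[OF p] unfolding two by (simp add: abs_mult)
  qed (simp_all add: cubefree_factor_prime(3))
  then show "summable (\<lambda>n. \<bar>?k n\<bar> * sqrt (real n))" by (simp add: abs_mult)
  have "(\<lambda>N. \<Prod>q\<le>N. if prime q then \<Sum>i\<le>2. ?k (q ^ i) else 1) \<longlonglongrightarrow> suminf ?k"
  proof (rule euler_product_bounded_exponent(2)[OF mk k0 _ b(1) _ b(2)])
    fix p :: nat assume p: "prime p"
    have "\<bar>?k p\<bar> * 1 + \<bar>?k (p ^ 2)\<bar> * 1 \<le> \<bar>?k p\<bar> * sqrt (real p) + \<bar>?k (p ^ 2)\<bar> * real p"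
      using prime_ge_1_nat[OF p] by (intro add_mono mult_left_mono) auto
    then show "(\<Sum>i = 1..2. \<bar>?k (p ^ i)\<bar>) \<le> b p"
      using bound[OF p] unfolding two by simp
  qed (simp add: cubefree_factor_prime(3))
  moreover define E where "E = (\<lambda>q. if prime q then 1 - 4 / real q ^ 2 + 4 / real q ^ 3 - 1 / real q ^ 4 else 1)"
  moreover have "(if prime q then \<Sum>i\<le>2. ?k (q ^ i) else 1) = E q" for q
  proof (cases "prime q")
    case True
    have "{..2::nat} = {0, 1, 2}" by auto
    then show ?thesis
      using True cubefree_factor_prime[OF True] multiplicative_1[OF mk] by (simp add: E_def)
  qed (simp add: E_def)
  ultimately have lim: "(\<lambda>N. \<Prod>q\<le>N. E q) \<longlonglongrightarrow> suminf ?k" by simp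
  have "summable (\<lambda>q. norm (E q - 1))"
  proof (rule summable_comparison_test'[OF b(1), of 1])
    fix q :: nat assume "q \<ge> 1"
    then have q: "real q \<ge> 1" by simp
    define A B D where "A = 1 / real q ^ 2" "B = 1 / real q ^ 3" "D = 1 / real q ^ 4"
    note ABD = this
    have "B \<le> A" "D \<le> A"
      unfolding ABD using q by (auto intro!: divide_left_mono power_increasing)
    moreover have "B \<ge> 0" "D \<ge> 0" "A \<ge> 0" by (simp_all add: ABD)
    moreover have "A \<le> sqrt (real q) / real q ^ 2"
      unfolding ABD using q by (intro divide_right_mono) auto
    moreover have "b q = 9 * (sqrt (real q) / real q ^ 2)" by (simp add: b_def)
    moreover have "E q - 1 = (if prime q then 4 * B - 4 * A - D else 0)"
      by (simp add: E_def ABD)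
    ultimately have "\<bar>E q - 1\<bar> \<le> b q" by (simp split: if_splits del: times_divide_eq_right)
    then show "norm (norm (E q - 1)) \<le> b q" by simp
  qed
  then have "convergent_prod E"
    by (intro abs_convergent_prod_imp_convergent_prod) (simp add: abs_convergent_prod_conv_summable)
  from LIMSEQ_unique[OF convergent_prod_LIMSEQ[OF this] lim]
  have "suminf ?k = prodinf E" by simp
  then show "zeta_real 2 * suminf ?k = gcud_const"
    by (simp add: gcud_const_def E_def)
qed

lemma zeta_real_2: "zeta_real 2 = (\<Sum>n. 1 / real n ^ 2)"
proof -
  have "summable (\<lambda>n. 1 / real n ^ 2)"
    using inverse_power_summable[of 2, where 'a = real] by (simp add: inverse_eq_divide)
  \<comment> \<open>The summand at 0 is \<open>1 / 0 = 0\<close>.\<close>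
  from suminf_split_head[OF this] show ?thesis
    by (simp add: zeta_real_def)
qed

lemma density_log_sum:
  "\<exists>C. \<forall>x\<ge>1. \<bar>(\<Sum>n = 1..nat \<lfloor>x\<rfloor>. unitary_totient n * coprime_density n ^ 2 / real n ^ 2)
    - gcud_const * ln x\<bar> \<le> C"
proof -
  have "\<exists>C. \<forall>x\<ge>1. \<bar>(\<Sum>n = 1..nat \<lfloor>x\<rfloor>. dconv (\<lambda>n. 1 / real n ^ 2) (\<lambda>n. 1 / real n) n)
      - 1 * (\<Sum>n. 1 / real n ^ 2) * ln x\<bar> \<le> C"
    using summable_sqrt_over_square
    by (intro log_sum_dconv[OF harmonic_sum_bound]) simp_all
  then obtain C where C: "\<And>x. x \<ge> 1 \<Longrightarrow>
      \<bar>(\<Sum>n = 1..nat \<lfloor>x\<rfloor>. dconv (\<lambda>n. 1 / real n ^ 2) (\<lambda>n. 1 / real n) n)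
      - zeta_real 2 * ln x\<bar> \<le> C"
    unfolding zeta_real_2 by auto
  have "cubefree_factor 0 = 0" by (simp add: cubefree_factor_def from_prime_powers_def)
  from log_sum_dconv[OF C this cubefree_factor_sums(1)]
  show ?thesis
    by (simp add: cubefree_factor_sums(2) density_factorization cong: sum.cong_simp)
qed

section \<open>The greatest common unitary divisor as a divisor sum\<close>

lemma coprime_iff_prime_factors:
  fixes d m :: nat
  assumes "d > 0"
  shows "coprime m d \<longleftrightarrow> (\<forall>p\<in>prime_factors d. \<not> p dvd m)"
proof
  assume "coprime m d"
  then show "\<forall>p\<in>prime_factors d. \<not> p dvd m"
    by (metis coprime_common_divisor in_prime_factors_iff not_prime_unit)
next
  assume *: "\<forall>p\<in>prime_factors d. \<not> p dvd m"
  show "coprime m d"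
  proof (rule ccontr)
    assume "\<not> coprime m d"
    then have "gcd m d \<noteq> 1" by (simp add: coprime_iff_gcd_eq_1)
    then obtain p where "prime p" "p dvd gcd m d" using prime_factor_nat by blast
    then show False using * assms by (auto simp: in_prime_factors_iff)
  qed
qed

text \<open>
  A unitary divisor contains each prime either to the full power or not at all.
\<close>

lemma unitary_dvd_iff_multiplicity:
  assumes "n > 0"
  shows "d \<parallel>\<^sub>u n \<longleftrightarrow> d > 0 \<and> (\<forall>p\<in>prime_factors d. multiplicity p d = multiplicity p n)"
proof
  assume d: "d \<parallel>\<^sub>u n"
  define m where "m = n div d"
  have n: "n = d * m" and cop: "coprime d m"
    using d by (simp_all add: unitary_dvd_def m_def)
  have pos: "d > 0" "m > 0" using assms n by (auto intro: gr0I)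
  then show "d > 0 \<and> (\<forall>p\<in>prime_factors d. multiplicity p d = multiplicity p n)"
    using cop by (auto simp: n multiplicity_coprime_times in_prime_factors_iff)
next
  assume d: "d > 0 \<and> (\<forall>p\<in>prime_factors d. multiplicity p d = multiplicity p n)"
  have "d dvd n"
  proof (rule multiplicity_le_imp_dvd)
    fix p :: nat assume p: "prime p"
    show "multiplicity p d \<le> multiplicity p n"
    proof (cases "p \<in> prime_factors d")
      case False
      then have "multiplicity p d = 0"
        using p by (metis gr0I prime_factors_multiplicity mem_Collect_eq)
      then show ?thesis by simp
    qed (use d in simp)
  qed (use d in simp)
  then obtain m where n: "n = d * m" by (auto elim: dvdE)
  have m: "m > 0" using n assms by (auto intro: gr0I)
  have "coprime d m"
  proof (rule ccontr)
    assume "\<not> coprime d m"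
    then obtain p where p: "prime p" "p dvd d" "p dvd m"
      by (metis coprime_iff_prime_factors[OF m, of d] in_prime_factors_iff)
    then have "p \<in> prime_factors d" using d by (simp add: in_prime_factors_iff)
    then have "multiplicity p d = multiplicity p d + multiplicity p m"
      using d m p(1) n by (metis prime_elem_multiplicity_mult_distrib not_gr0 prime_imp_prime_elem)
    moreover have "multiplicity p m > 0"
      using p m by (simp add: prime_multiplicity_gt_zero_iff)
    ultimately show False by simp
  qed
  then show "d \<parallel>\<^sub>u n" using assms d by (simp add: unitary_dvd_def n)
qed

lemma prime_factors_prod_prime_powers:
  fixes S :: "nat set"
  assumes "finite S" "\<And>p. p \<in> S \<Longrightarrow> prime p" "\<And>p. p \<in> S \<Longrightarrow> f p > 0"
  shows "prime_factors (\<Prod>p\<in>S. p ^ f p) = S"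
proof -
  have "multiplicity q (\<Prod>p\<in>S. p ^ f p) = (if q \<in> S then f q else 0)" if "prime q" for q
    using assms that by (intro multiplicity_prod_prime_powers) auto
  then show ?thesis using assms(2,3)
    by (auto simp: prime_factors_multiplicity split: if_splits)
qed

lemma prod_prime_powers_multiplicity:
  fixes d :: nat
  assumes "d > 0"
  shows "(\<Prod>p\<in>prime_factors d. p ^ multiplicity p d) = d"
  using assms prime_factorization_nat by simp

text \<open>
  The common unitary divisors of \<open>i\<close> and \<open>j\<close> are the products of \<open>p\<^sup>v\<close> over the subsets of
  the set \<open>T\<close> of primes that occur in \<open>i\<close> and \<open>j\<close> with the same exponent \<open>v > 0\<close>. The largest one
  belongs to \<open>T\<close> itself, and expanding \<open>\<Prod>p\<in>T. (p\<^sup>v - 1) + 1\<close> over the subsets of \<open>T\<close> gives the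
  sum of the unitary totients.
\<close>

lemma gcud_eq_sum_unitary_totient:
  assumes i: "i > 0" and j: "j > 0"
  shows "real (gcud i j) = (\<Sum>d | d \<parallel>\<^sub>u i \<and> d \<parallel>\<^sub>u j. unitary_totient d)"
proof -
  define T where "T = {p \<in> prime_factors i. multiplicity p i = multiplicity p j}"
  define P where "P = (\<lambda>S. \<Prod>p\<in>S. p ^ multiplicity p i)"
  have T: "finite T" "\<And>p. p \<in> T \<Longrightarrow> prime p" "\<And>p. p \<in> T \<Longrightarrow> multiplicity p i > 0"
    by (simp add: T_def) (auto simp: T_def prime_factors_multiplicity)
  have P: "P S > 0" "prime_factors (P S) = S"
    "\<And>p. p \<in> S \<Longrightarrow> multiplicity p (P S) = multiplicity p i" if "S \<subseteq> T" for S
  proof -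
    have S: "finite S" "\<And>p. p \<in> S \<Longrightarrow> prime p" "\<And>p. p \<in> S \<Longrightarrow> multiplicity p i > 0"
      using T that by (auto intro: finite_subset)
    show "P S > 0" using S(2) unfolding P_def by (intro prod_pos) (auto simp: prime_gt_0_nat)
    show "prime_factors (P S) = S"
      unfolding P_def by (rule prime_factors_prod_prime_powers[OF S])
    show "multiplicity p (P S) = multiplicity p i" if "p \<in> S" for p
      unfolding P_def using S that by (subst multiplicity_prod_prime_powers) auto
  qed
  have inj: "inj_on P (Pow T)"
    by (rule inj_onI) (metis P(2) PowD)
  have common: "{d. d \<parallel>\<^sub>u i \<and> d \<parallel>\<^sub>u j} = P ` Pow T"
  proof (intro equalityI subsetI)
    fix d assume "d \<in> {d. d \<parallel>\<^sub>u i \<and> d \<parallel>\<^sub>u j}"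
    then have d: "d > 0" "\<And>p. p \<in> prime_factors d \<Longrightarrow> multiplicity p d = multiplicity p i"
      "\<And>p. p \<in> prime_factors d \<Longrightarrow> multiplicity p d = multiplicity p j"
      using i j by (auto simp: unitary_dvd_iff_multiplicity)
    have "prime_factors d \<subseteq> T"
    proof
      fix p assume p: "p \<in> prime_factors d"
      then have "multiplicity p i > 0" using d(2)[OF p] by (simp add: prime_factors_multiplicity)
      then show "p \<in> T" using p d(2,3)[OF p] by (simp add: T_def prime_factors_multiplicity)
    qed
    moreover have "P (prime_factors d) = (\<Prod>p\<in>prime_factors d. p ^ multiplicity p d)"
      unfolding P_def using d(2) by (intro prod.cong) auto
    ultimately show "d \<in> P ` Pow T"
      using prod_prime_powers_multiplicity[OF d(1)] by (intro image_eqI[of _ _ "prime_factors d"]) auto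
  next
    fix d assume "d \<in> P ` Pow T"
    then obtain S where S: "S \<subseteq> T" "d = P S" by auto
    then show "d \<in> {d. d \<parallel>\<^sub>u i \<and> d \<parallel>\<^sub>u j}"
      using P[OF S(1)] i j by (auto simp: unitary_dvd_iff_multiplicity T_def)
  qed
  have "gcud i j = P T"
    unfolding gcud_def common
  proof (rule Max_eqI)
    fix d assume "d \<in> P ` Pow T"
    then obtain S where S: "S \<subseteq> T" "d = P S" by auto
    have "P S dvd P T" unfolding P_def by (rule prod_dvd_prod_subset[OF T(1) S(1)])
    then show "d \<le> P T" using P(1)[of T] S(2) by (simp add: dvd_imp_le)
  qed (use T(1) in auto)
  also have "real (P T) = (\<Prod>p\<in>T. (real p ^ multiplicity p i - 1) + 1)"
    by (simp add: P_def)
  also have "\<dots> = (\<Sum>S\<in>Pow T. \<Prod>p\<in>S. real p ^ multiplicity p i - 1)"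
    using prod_add[OF T(1), of "\<lambda>p. real p ^ multiplicity p i - 1" "\<lambda>_. 1"] by simp
  also have "\<dots> = (\<Sum>S\<in>Pow T. unitary_totient (P S))"
  proof (intro sum.cong refl)
    fix S assume "S \<in> Pow T"
    then show "(\<Prod>p\<in>S. real p ^ multiplicity p i - 1) = unitary_totient (P S)"
      using P[of S] by (auto simp: unitary_totient_def from_prime_powers_def intro!: prod.cong)
  qed
  also have "\<dots> = (\<Sum>d | d \<parallel>\<^sub>u i \<and> d \<parallel>\<^sub>u j. unitary_totient d)"
    by (simp add: common sum.reindex[OF inj])
  finally show ?thesis .
qed

definition coprime_count :: "nat \<Rightarrow> nat \<Rightarrow> nat"
  where "coprime_count d N = card {m \<in> {1..N}. coprime m d}"

lemma card_unitary_multiples: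
  assumes "d > 0"
  shows "card {n \<in> {1..N}. d \<parallel>\<^sub>u n} = coprime_count d (N div d)"
proof -
  have "bij_betw (\<lambda>m. d * m) {m \<in> {1..N div d}. coprime m d} {n \<in> {1..N}. d \<parallel>\<^sub>u n}"
  proof (rule bij_betw_byWitness[where f' = "\<lambda>n. n div d"])
    show "(\<lambda>m. d * m) ` {m \<in> {1..N div d}. coprime m d} \<subseteq> {n \<in> {1..N}. d \<parallel>\<^sub>u n}"
      using assms by (auto simp: unitary_dvd_def less_eq_div_iff_mult_less_eq mult.commute coprime_commute)
    show "(\<lambda>n. n div d) ` {n \<in> {1..N}. d \<parallel>\<^sub>u n} \<subseteq> {m \<in> {1..N div d}. coprime m d}"
      using assms by (auto simp: unitary_dvd_def coprime_commute intro!: div_le_mono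
          dest: dvd_imp_le simp: Suc_le_eq div_greater_zero_iff)
  qed (use assms in \<open>auto simp: unitary_dvd_def\<close>)
  from bij_betw_same_card[OF this] show ?thesis by (simp add: coprime_count_def)
qed

lemma gcud_sum:
  "(\<Sum>i = 1..N. \<Sum>j = 1..N. real (gcud i j)) =
    (\<Sum>d = 1..N. unitary_totient d * real (coprime_count d (N div d)) ^ 2)"
proof -
  have "real (gcud i j) = (\<Sum>d = 1..N. unitary_totient d * (of_bool (d \<parallel>\<^sub>u i) * of_bool (d \<parallel>\<^sub>u j)))"
    if ij: "i \<in> {1..N}" "j \<in> {1..N}" for i j
  proof -
    have "{d. d \<parallel>\<^sub>u i \<and> d \<parallel>\<^sub>u j} = {d \<in> {1..N}. d \<parallel>\<^sub>u i \<and> d \<parallel>\<^sub>u j}"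
      using ij by (auto simp: unitary_dvd_def Suc_le_eq intro: dvd_pos_nat dest: dvd_imp_le)
    then have "real (gcud i j) = (\<Sum>d | d \<in> {1..N} \<and> d \<parallel>\<^sub>u i \<and> d \<parallel>\<^sub>u j. unitary_totient d)"
      using ij by (simp add: gcud_eq_sum_unitary_totient)
    also have "\<dots> = (\<Sum>d = 1..N. if d \<parallel>\<^sub>u i \<and> d \<parallel>\<^sub>u j then unitary_totient d else 0)"
      by (intro sum.inter_filter) simp
    also have "\<dots> = (\<Sum>d = 1..N. unitary_totient d * (of_bool (d \<parallel>\<^sub>u i) * of_bool (d \<parallel>\<^sub>u j)))"
      by (intro sum.cong refl) simp
    finally show ?thesis .
  qed
  then have "(\<Sum>i = 1..N. \<Sum>j = 1..N. real (gcud i j)) = (\<Sum>i = 1..N. \<Sum>j = 1..N. \<Sum>d = 1..N.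
      unitary_totient d * (of_bool (d \<parallel>\<^sub>u i) * of_bool (d \<parallel>\<^sub>u j)))"
    by (intro sum.cong refl) blast
  also have "\<dots> = (\<Sum>i = 1..N. \<Sum>d = 1..N. \<Sum>j = 1..N.
      unitary_totient d * (of_bool (d \<parallel>\<^sub>u i) * of_bool (d \<parallel>\<^sub>u j)))"
    by (intro sum.cong refl sum.swap)
  also have "\<dots> = (\<Sum>d = 1..N. \<Sum>i = 1..N. \<Sum>j = 1..N.
      unitary_totient d * (of_bool (d \<parallel>\<^sub>u i) * of_bool (d \<parallel>\<^sub>u j)))"
    by (rule sum.swap)
  also have "\<dots> = (\<Sum>d = 1..N. unitary_totient d * (\<Sum>i = 1..N. of_bool (d \<parallel>\<^sub>u i)) ^ 2)"
    by (intro sum.cong refl, simp only: sum_product power2_eq_square, simp only: sum_distrib_left)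
  also have "\<dots> = (\<Sum>d = 1..N. unitary_totient d * real (coprime_count d (N div d)) ^ 2)"
  proof (intro sum.cong refl)
    fix d assume "d \<in> {1..N}"
    then have "real (coprime_count d (N div d)) = real (card {n \<in> {1..N}. d \<parallel>\<^sub>u n})"
      using card_unitary_multiples[of d N] by simp
    also have "\<dots> = (\<Sum>i = 1..N. of_bool (d \<parallel>\<^sub>u i))"
      by (simp add: sum.If_cases of_bool_def Int_def)
    finally show "unitary_totient d * (\<Sum>i = 1..N. of_bool (d \<parallel>\<^sub>u i)) ^ 2 =
        unitary_totient d * real (coprime_count d (N div d)) ^ 2" by simp
  qed
  finally show ?thesis .
qed

section \<open>Counting integers coprime to d\<close>

text \<open>
  Induction on the set of primes: the integers up to \<open>y\<close> that survive the sieve by \<open>S\<close> but not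
  the further sieve by \<open>p\<close> are \<open>p\<close> times the survivors up to \<open>y / p\<close>. The errors at \<open>y\<close> and \<open>y / p\<close>
  add up, which produces the factor \<open>1 + 1/sqrt p\<close>. For the empty set the error of the floor
  function is at most \<open>min 1 y \<le> sqrt y\<close>. Any exponent strictly between 0 and 1 in place of 1/2
  would serve; at 0 and at 1 the average over \<open>d\<close> costs a logarithm.
\<close>

lemma sieve_bound:
  assumes "finite S" "\<And>p. p \<in> S \<Longrightarrow> prime p" "y \<ge> 0"
  shows "\<bar>real (card {m \<in> {1..nat \<lfloor>y\<rfloor>}. \<forall>p\<in>S. \<not> p dvd m}) - y * (\<Prod>p\<in>S. 1 - 1 / real p)\<bar>
    \<le> sqrt y * (\<Prod>p\<in>S. 1 + 1 / sqrt (real p))"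
  using assms
proof (induction S arbitrary: y rule: finite_induct)
  case (empty y)
  have "\<bar>real (nat \<lfloor>y\<rfloor>) - y\<bar> \<le> sqrt y"
  proof (cases "y < 1")
    case True
    then have "\<lfloor>y\<rfloor> = 0" using empty by (simp add: floor_eq_iff)
    moreover have "y * y \<le> y" using True empty by (simp add: mult_left_le)
    then have "y \<le> sqrt y" by (intro real_le_rsqrt) (simp add: power2_eq_square)
    ultimately show ?thesis using empty by simp
  next
    case False
    then have "sqrt y \<ge> 1" by simp
    moreover have "real (nat \<lfloor>y\<rfloor>) = of_int \<lfloor>y\<rfloor>" using empty by simp
    ultimately show ?thesis by linarith
  qed
  moreover have "{m \<in> {1..nat \<lfloor>y\<rfloor>}. \<forall>p\<in>{}. \<not> p dvd m} = {1..nat \<lfloor>y\<rfloor>}" by auto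
  ultimately show ?case by simp
next
  case (insert p S y)
  define X where "X = (\<lambda>y::real. {m \<in> {1..nat \<lfloor>y\<rfloor>}. \<forall>q\<in>S. \<not> q dvd m})"
  have p: "prime p" and S: "\<And>q. q \<in> S \<Longrightarrow> prime q" and y: "y \<ge> 0"
    using insert.prems by auto
  have p0: "p > 0" by (rule prime_gt_0_nat[OF p])
  have fl: "nat \<lfloor>y / real p\<rfloor> = nat \<lfloor>y\<rfloor> div p" by (rule nat_floor_divide[OF y])
  have iff: "q dvd p * l \<longleftrightarrow> q dvd l" if "q \<in> S" for q l
    using S[OF that] that p insert.hyps(2) by (metis prime_dvd_mult_iff primes_dvd_imp_eq)
  have "bij_betw (\<lambda>l. p * l) (X (y / real p)) {m \<in> X y. p dvd m}"
  proof (rule bij_betw_byWitness[where f' = "\<lambda>m. m div p"])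
    show "(\<lambda>l. p * l) ` X (y / real p) \<subseteq> {m \<in> X y. p dvd m}"
      using p0 iff by (auto simp: X_def fl less_eq_div_iff_mult_less_eq mult.commute[of p])
    show "(\<lambda>m. m div p) ` {m \<in> X y. p dvd m} \<subseteq> X (y / real p)"
    proof clarify
      fix m assume m: "m \<in> X y" "p dvd m"
      then obtain l where "m = p * l" by (auto elim: dvdE)
      then show "m div p \<in> X (y / real p)"
        using m p0 iff by (auto simp: X_def fl less_eq_div_iff_mult_less_eq mult.commute[of p] Suc_le_eq)
    qed
  qed (use p0 in auto)
  then have c1: "card {m \<in> X y. p dvd m} = card (X (y / real p))"
    using bij_betw_same_card by metis
  have "card (X y) = card ({m \<in> X y. p dvd m} \<union> {m \<in> X y. \<not> p dvd m})"
    by (rule arg_cong[where f = card]) auto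
  also have "\<dots> = card {m \<in> X y. p dvd m} + card {m \<in> X y. \<not> p dvd m}"
    by (intro card_Un_disjoint) (auto simp: X_def)
  also have "{m \<in> X y. \<not> p dvd m} = {m \<in> {1..nat \<lfloor>y\<rfloor>}. \<forall>q\<in>insert p S. \<not> q dvd m}"
    by (auto simp: X_def)
  finally have cnt: "real (card {m \<in> {1..nat \<lfloor>y\<rfloor>}. \<forall>q\<in>insert p S. \<not> q dvd m}) =
      real (card (X y)) - real (card (X (y / real p)))"
    using c1 by simp
  define R W where "R = (\<Prod>q\<in>S. 1 - 1 / real q)" and "W = (\<Prod>q\<in>S. 1 + 1 / sqrt (real q))"
  have "\<bar>real (card (X y)) - y * R\<bar> \<le> sqrt y * W"
    using insert.IH[OF S y] by (simp add: X_def R_def W_def)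
  moreover have "\<bar>real (card (X (y / real p))) - y / real p * R\<bar> \<le> sqrt (y / real p) * W"
    using insert.IH[OF S, of "y / real p"] y by (simp add: X_def R_def W_def)
  moreover have y_R: "y * (\<Prod>q\<in>insert p S. 1 - 1 / real q) = y * R - y / real p * R"
    using insert.hyps by (simp add: R_def algebra_simps)
  moreover have y_W: "sqrt y * (\<Prod>q\<in>insert p S. 1 + 1 / sqrt (real q)) =
      sqrt y * W + sqrt (y / real p) * W"
    using insert.hyps by (simp add: W_def real_sqrt_divide algebra_simps)
  ultimately show ?case unfolding cnt y_R y_W by linarith
qed

text \<open>
  Expanding the product gives the sum of \<open>1/sqrt e\<close> over the squarefree divisors \<open>e\<close> of \<open>d\<close> only.
\<close>

lemma prime_factor_prod_le_divisor_sum: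
  assumes "d > 0"
  shows "(\<Prod>p\<in>prime_factors d. 1 + 1 / sqrt (real p)) \<le> (\<Sum>e | e dvd d. 1 / sqrt (real e))"
proof -
  have pf: "finite X" "\<And>p. p \<in> X \<Longrightarrow> prime p" if "X \<in> Pow (prime_factors d)" for X
    using that by (auto intro: finite_subset)
  have inj: "inj_on (\<lambda>X. \<Prod>p\<in>X. p) (Pow (prime_factors d))"
  proof (rule inj_onI)
    fix X Y assume *: "X \<in> Pow (prime_factors d)" "Y \<in> Pow (prime_factors d)" "\<Prod>X = \<Prod>Y"
    then show "X = Y"
      using prime_factors_prod_prime_powers[OF pf[OF *(1)], of "\<lambda>_. 1"]
        prime_factors_prod_prime_powers[OF pf[OF *(2)], of "\<lambda>_. 1"] by simp
  qed
  have "(\<Prod>p\<in>prime_factors d. 1 + 1 / sqrt (real p)) =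
      (\<Prod>p\<in>prime_factors d. 1 / sqrt (real p) + 1)"
    by (simp add: add.commute)
  also have "\<dots> = (\<Sum>X\<in>Pow (prime_factors d). \<Prod>p\<in>X. 1 / sqrt (real p))"
    by (simp add: prod_add)
  also have "\<dots> = (\<Sum>X\<in>Pow (prime_factors d). 1 / sqrt (real (\<Prod>p\<in>X. p)))"
  proof (intro sum.cong refl)
    fix X assume "X \<in> Pow (prime_factors d)"
    from pf(1)[OF this] show "(\<Prod>p\<in>X. 1 / sqrt (real p)) = 1 / sqrt (real (\<Prod>p\<in>X. p))"
      by (induction rule: finite_induct) (simp_all add: real_sqrt_mult)
  qed
  also have "\<dots> = (\<Sum>e\<in>(\<lambda>X. \<Prod>p\<in>X. p) ` Pow (prime_factors d). 1 / sqrt (real e))"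
    by (simp add: sum.reindex[OF inj])
  also have "\<dots> \<le> (\<Sum>e | e dvd d. 1 / sqrt (real e))"
  proof (rule sum_mono2)
    show "(\<lambda>X. \<Prod>p\<in>X. p) ` Pow (prime_factors d) \<subseteq> {e. e dvd d}"
    proof clarify
      fix X assume "X \<subseteq> prime_factors d"
      then have "(\<Prod>p\<in>X. p) dvd (\<Prod>p\<in>prime_factors d. p)"
        by (intro prod_dvd_prod_subset) auto
      also have "\<dots> dvd (\<Prod>p\<in>prime_factors d. p ^ multiplicity p d)"
        by (intro prod_dvd_prod) (auto simp: prime_factors_multiplicity intro: dvd_power)
      also have "\<dots> = d" by (rule prod_prime_powers_multiplicity[OF assms])
      finally show "(\<Prod>p\<in>X. p) dvd d" .
    qed
  qed (use assms in auto)
  finally show ?thesis .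
qed

section \<open>The total sieve error\<close>

lemma sum_inverse_sqrt_le: "(\<Sum>k = 1..M. 1 / sqrt (real k)) \<le> 2 * sqrt (real M)"
proof (induction M)
  case (Suc M)
  define a b where "a = sqrt (real M)" and "b = sqrt (real (Suc M))"
  have ab: "a \<le> b" "b > 0" "a \<ge> 0" "b\<^sup>2 = a\<^sup>2 + 1" by (simp_all add: a_def b_def)
  have "0 \<le> (b - a)\<^sup>2" by simp
  then have "1 \<le> 2 * (b - a) * b" using ab(4) by (simp add: power2_eq_square algebra_simps)
  then have "1 / b \<le> 2 * (b - a)" using ab(2) by (simp add: divide_le_eq)
  then show ?case using Suc by (simp add: a_def b_def)
qed simp

text \<open>
  With \<open>d = e k\<close> the summand is \<open>1/e * 1/sqrt k\<close>. The sum over \<open>k \<le> N/e\<close> is at most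
  \<open>2 sqrt (N/e)\<close>, and the remaining sum over \<open>e\<close> of \<open>e\<^bsup>-3/2\<^esup>\<close> converges. The term \<open>e\<^bsup>-3/2\<^esup>\<close> is written
  \<open>sqrt e / e\<^sup>2\<close> to match \<open>summable_sqrt_over_square\<close>.
\<close>

lemma sum_divisor_sum_bound:
  "(\<Sum>d = 1..N. 1 / sqrt (real d) * (\<Sum>e | e dvd d. 1 / sqrt (real e)))
    \<le> 2 * (\<Sum>n. sqrt (real n) / real n ^ 2) * sqrt (real N)"
proof -
  have "(\<Sum>d = 1..N. 1 / sqrt (real d) * (\<Sum>e | e dvd d. 1 / sqrt (real e))) =
      (\<Sum>d = 1..N. dconv (\<lambda>e. 1 / real e) (\<lambda>k. 1 / sqrt (real k)) d)"
  proof (intro sum.cong refl)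
    fix d assume "d \<in> {1..N}"
    show "1 / sqrt (real d) * (\<Sum>e | e dvd d. 1 / sqrt (real e)) =
        dconv (\<lambda>e. 1 / real e) (\<lambda>k. 1 / sqrt (real k)) d"
      unfolding dconv_def sum_distrib_left
    proof (intro sum.cong refl)
      fix e assume "e \<in> {e. e dvd d}"
      then obtain k where d: "d = e * k" by (auto elim: dvdE)
      then have "e > 0" "k > 0" using \<open>d \<in> {1..N}\<close> by (auto intro: gr0I)
      then show "1 / sqrt (real d) * (1 / sqrt (real e)) = 1 / real e * (1 / sqrt (real (d div e)))"
        by (simp add: d real_sqrt_mult)
    qed
  qed
  also have "\<dots> = (\<Sum>e = 1..N. 1 / real e * (\<Sum>k = 1..N div e. 1 / sqrt (real k)))"
    by (rule sum_dconv)
  also have "\<dots> \<le> (\<Sum>e = 1..N. 2 * sqrt (real N) * (sqrt (real e) / real e ^ 2))"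
  proof (rule sum_mono)
    fix e assume "e \<in> {1..N}"
    then have e: "e > 0" by simp
    have "(\<Sum>k = 1..N div e. 1 / sqrt (real k)) \<le> 2 * sqrt (real (N div e))"
      by (rule sum_inverse_sqrt_le)
    also have "\<dots> \<le> 2 * sqrt (real N / real e)"
      by (simp add: of_nat_div_le_of_nat)
    finally have "1 / real e * (\<Sum>k = 1..N div e. 1 / sqrt (real k)) \<le>
        1 / real e * (2 * sqrt (real N / real e))"
      by (intro mult_left_mono) auto
    also have "\<dots> = 2 * sqrt (real N) * (1 / (real e * sqrt (real e)))"
      by (simp add: real_sqrt_divide)
    also have "1 / (real e * sqrt (real e)) = sqrt (real e) / real e ^ 2"
      using e by (simp add: field_simps power2_eq_square)
    finally show "1 / real e * (\<Sum>k = 1..N div e. 1 / sqrt (real k)) \<le>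
        2 * sqrt (real N) * (sqrt (real e) / real e ^ 2)" .
  qed
  also have "\<dots> = 2 * sqrt (real N) * (\<Sum>e = 1..N. sqrt (real e) / real e ^ 2)"
    by (simp add: sum_distrib_left)
  also have "\<dots> \<le> 2 * sqrt (real N) * (\<Sum>n. sqrt (real n) / real n ^ 2)"
    by (intro mult_left_mono sum_le_suminf summable_sqrt_over_square) auto
  finally show ?thesis by (simp add: mult_ac)
qed

lemma unitary_totient_bounds: "0 \<le> unitary_totient d \<and> unitary_totient d \<le> real d"
proof (cases "d = 0")
  case False
  have *: "real p ^ multiplicity p d \<ge> 1" if "p \<in> prime_factors d" for p
    using that by (intro one_le_power) (auto simp: in_prime_factors_iff prime_ge_1_nat)
  have "unitary_totient d = (\<Prod>p\<in>prime_factors d. real p ^ multiplicity p d - 1)"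
    using False by (simp add: unitary_totient_def from_prime_powers_def)
  moreover have "\<dots> \<le> (\<Prod>p\<in>prime_factors d. real p ^ multiplicity p d)"
    using * by (intro prod_mono) auto
  moreover have "\<dots> = real d"
    using False by (simp flip: of_nat_power of_nat_prod add: prod_prime_powers_multiplicity)
  moreover have "(\<Prod>p\<in>prime_factors d. real p ^ multiplicity p d - 1) \<ge> 0"
    using * by (intro prod_nonneg) auto
  ultimately show ?thesis by simp
qed (simp add: unitary_totient_def from_prime_powers_def)

text \<open>
  The count and its approximation both lie between 0 and \<open>y = x/d\<close>, so the difference of their
  squares is at most \<open>2 y\<close> times the error of the count; no square of the error appears.
\<close>

lemma coprime_count_square_error:
  assumes d: "d > 0" and x: "x \<ge> 0"
  shows "\<bar>real (coprime_count d (nat \<lfloor>x\<rfloor> div d)) ^ 2 - (x / real d * coprime_density d) ^ 2\<bar>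
    \<le> 2 * (x / real d) * sqrt (x / real d) * (\<Sum>e | e dvd d. 1 / sqrt (real e))"
proof -
  define y where "y = x / real d"
  define c where "c = real (coprime_count d (nat \<lfloor>x\<rfloor> div d))"
  define r where "r = coprime_density d"
  have y: "y \<ge> 0" using x by (simp add: y_def)
  have fl: "nat \<lfloor>x\<rfloor> div d = nat \<lfloor>y\<rfloor>" using nat_floor_divide[OF x] by (simp add: y_def)
  have r: "r = (\<Prod>p\<in>prime_factors d. 1 - 1 / real p)"
    using d by (simp add: r_def coprime_density_def from_prime_powers_def)
  have "c = real (card {m \<in> {1..nat \<lfloor>y\<rfloor>}. \<forall>p\<in>prime_factors d. \<not> p dvd m})"
    by (simp add: c_def coprime_count_def fl coprime_iff_prime_factors[OF d])
  then have "\<bar>c - y * r\<bar> \<le> sqrt y * (\<Prod>p\<in>prime_factors d. 1 + 1 / sqrt (real p))"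
    using sieve_bound[of "prime_factors d" y] y unfolding r by auto
  also have "\<dots> \<le> sqrt y * (\<Sum>e | e dvd d. 1 / sqrt (real e))"
    using prime_factor_prod_le_divisor_sum[OF d] y by (intro mult_left_mono) auto
  finally have err: "\<bar>c - y * r\<bar> \<le> sqrt y * (\<Sum>e | e dvd d. 1 / sqrt (real e))" .
  have "coprime_count d (nat \<lfloor>y\<rfloor>) \<le> card {1..nat \<lfloor>y\<rfloor>}"
    unfolding coprime_count_def by (intro card_mono) auto
  then have c: "0 \<le> c" "c \<le> y" using y by (simp_all add: c_def fl) linarith
  have "0 \<le> r \<and> r \<le> 1"
    unfolding r by (auto intro!: prod_nonneg prod_le_1 simp: in_prime_factors_iff divide_le_eq_1
        dest!: prime_ge_1_nat)
  then have yr: "0 \<le> y * r" "y * r \<le> y" using y by (simp_all add: mult_left_le)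
  have "\<bar>c ^ 2 - (y * r) ^ 2\<bar> = \<bar>c + y * r\<bar> * \<bar>c - y * r\<bar>"
    by (simp add: power2_eq_square algebra_simps flip: abs_mult)
  also have "\<dots> \<le> (2 * y) * (sqrt y * (\<Sum>e | e dvd d. 1 / sqrt (real e)))"
    using c yr y err by (intro mult_mono) auto
  finally show ?thesis by (simp add: c_def y_def r_def mult_ac)
qed

text \<open>
  As \<open>\<phi>\<^sup>*(d) \<le> d\<close>, the term for \<open>d\<close> is off by at most \<open>2 x sqrt x\<close> times \<open>1/sqrt d\<close> times the divisor
  sum, and the sum of the latter over \<open>d \<le> x\<close> is \<open>O(sqrt x)\<close>.
\<close>

lemma gcud_sum_approximation:
  assumes x: "x \<ge> 1"
  shows "\<bar>(\<Sum>i = 1..nat \<lfloor>x\<rfloor>. \<Sum>j = 1..nat \<lfloor>x\<rfloor>. real (gcud i j)) -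
      x ^ 2 * (\<Sum>d = 1..nat \<lfloor>x\<rfloor>. unitary_totient d * coprime_density d ^ 2 / real d ^ 2)\<bar>
    \<le> 4 * (\<Sum>n. sqrt (real n) / real n ^ 2) * x ^ 2"
proof -
  define N where "N = nat \<lfloor>x\<rfloor>"
  define w where "w = (\<lambda>d. \<Sum>e | e dvd d. 1 / sqrt (real e))"
  define Z where "Z = (\<Sum>n. sqrt (real n) / real n ^ 2)"
  have w: "w d \<ge> 0" for d by (simp add: w_def sum_nonneg)
  have Z: "Z \<ge> 0" unfolding Z_def by (intro suminf_nonneg summable_sqrt_over_square) simp
  have N: "real N \<le> x" using x by (simp add: N_def)
  have "(\<Sum>i = 1..N. \<Sum>j = 1..N. real (gcud i j)) -
      x ^ 2 * (\<Sum>d = 1..N. unitary_totient d * coprime_density d ^ 2 / real d ^ 2) =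
      (\<Sum>d = 1..N. unitary_totient d *
        (real (coprime_count d (N div d)) ^ 2 - (x / real d * coprime_density d) ^ 2))"
    unfolding gcud_sum
    by (simp add: sum_distrib_left sum_subtractf power_divide power_mult_distrib
        right_diff_distrib mult_ac)
  also have "\<bar>\<dots>\<bar> \<le> (\<Sum>d = 1..N. 2 * x * sqrt x * (1 / sqrt (real d) * w d))"
  proof (rule order_trans[OF sum_abs sum_mono])
    fix d assume "d \<in> {1..N}"
    then have d: "d > 0" by simp
    have "\<bar>unitary_totient d * (real (coprime_count d (N div d)) ^ 2 - (x / real d * coprime_density d) ^ 2)\<bar>
        \<le> real d * (2 * (x / real d) * sqrt (x / real d) * w d)"
      unfolding abs_mult N_def w_def using unitary_totient_bounds[of d] x d
      by (intro mult_mono coprime_count_square_error) auto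
    also have "\<dots> = 2 * x * sqrt x * (1 / sqrt (real d) * w d)"
      using d by (simp add: real_sqrt_divide)
    finally show "\<bar>unitary_totient d * (real (coprime_count d (N div d)) ^ 2 -
        (x / real d * coprime_density d) ^ 2)\<bar> \<le> 2 * x * sqrt x * (1 / sqrt (real d) * w d)" .
  qed
  also have "\<dots> = 2 * x * sqrt x * (\<Sum>d = 1..N. 1 / sqrt (real d) * w d)"
    by (simp add: sum_distrib_left)
  also have "\<dots> \<le> 2 * x * sqrt x * (2 * Z * sqrt (real N))"
    unfolding w_def Z_def using x by (intro mult_left_mono sum_divisor_sum_bound) auto
  also have "\<dots> \<le> 2 * x * sqrt x * (2 * Z * sqrt x)"
    using x Z N by (intro mult_left_mono) auto
  also have "\<dots> = 4 * Z * x * (sqrt x * sqrt x)"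
    by (simp add: mult_ac)
  also have "\<dots> = 4 * Z * x ^ 2"
    using x by (simp add: power2_eq_square)
  finally show ?thesis by (simp add: N_def Z_def)
qed

theorem theorem6p4:
  shows "(\<lambda>x::real. (\<Sum>i = 1..nat \<lfloor>x\<rfloor>. \<Sum>j = 1..nat \<lfloor>x\<rfloor>. real (gcud i j))
            - gcud_const * x ^ 2 * ln x) \<in> O[at_top](\<lambda>x. x ^ 2)"
proof -
  define Z where "Z = (\<Sum>n. sqrt (real n) / real n ^ 2)"
  obtain C where C: "\<And>x. x \<ge> 1 \<Longrightarrow>
      \<bar>(\<Sum>n = 1..nat \<lfloor>x\<rfloor>. unitary_totient n * coprime_density n ^ 2 / real n ^ 2)
        - gcud_const * ln x\<bar> \<le> C"
    using density_log_sum by blast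
  have "\<forall>\<^sub>F x in at_top. norm ((\<Sum>i = 1..nat \<lfloor>x\<rfloor>. \<Sum>j = 1..nat \<lfloor>x\<rfloor>. real (gcud i j))
      - gcud_const * x ^ 2 * ln x) \<le> (4 * Z + C) * norm (x ^ 2)"
    using eventually_ge_at_top[of 1]
  proof eventually_elim
    case (elim x)
    define A where "A = (\<Sum>n = 1..nat \<lfloor>x\<rfloor>. unitary_totient n * coprime_density n ^ 2 / real n ^ 2)"
    have "\<bar>x ^ 2 * (A - gcud_const * ln x)\<bar> \<le> x ^ 2 * C"
      using C[OF elim] by (simp add: abs_mult A_def mult_left_mono)
    moreover have "x ^ 2 * (A - gcud_const * ln x) = x ^ 2 * A - gcud_const * x ^ 2 * ln x"
      by (simp add: algebra_simps)
    ultimately show ?case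
      using gcud_sum_approximation[OF elim]
      unfolding A_def[symmetric] Z_def[symmetric] by (simp add: algebra_simps)
  qed
  then show ?thesis by (rule bigoI)
qed

end
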